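(* Let $m \ge 1$ be an integer and let $n = 2m$. If $A = [a_0,\dotsc,a_{n-1}]$, $B = [b_0,\dotsc,b_{n-1}]$, $C = [c_0,\dotsc,c_{n-1}]$, $D = [d_0,\dotsc,d_{n-1}]$ is a Williamson sequence of (even) order $n = 2m$, then \[ a_i b_i c_i d_i = a_{i+m} b_{i+m} c_{i+m} d_{i+m} \quad \text{for all } 0 \le i < m. \]
   Context: For a sequence $X = [x_0,\dotsc,x_{n-1}]$, let $\operatorname{circ}(x_0,\dotsc,x_{n-1})$ denote the $n\times n$ circulant matrix with first row $(x_0,\dotsc,x_{n-1})$, i.e., the matrix whose $(j,k)$ entry ($0\le j,k<n$) is $x_{(k-j) \bmod n}$. Four $n\times n$ matrices with $\pm 1$ entries are called Williamson matrices of order $n$ if each is symmetric and circulant and, denoting them $A,B,C,D$, they satisfy $A^2+B^2+C^2+D^2 = 4nI_n$, where $I_n$ is the $n\times n$ identity matrix. A Williamson sequence of order $n$ is a quadruple $A,B,C,D$ of sequences of length $n$ (indexed from $0$ to $n-1$, with $\pm1$ entries) that are the first rows of four Williamson matrices of order $n$, i.e., such that the four circulant matrices they define are symmetric (equivalently $x_i = x_{n-i}$ for $1\le i<n$ for each sequence $X=[x_0,\dotsc,x_{n-1}]$ among them) and the squares of these matrices sum to $4nI_n$. *)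

theory Defs
  imports "Jordan_Normal_Form.Matrix"
begin

text \<open>The entry in position (j, k) is the one with index k - j modulo n; the summand n keeps
  the subtraction of natural numbers from truncating, as j < n.\<close>
definition circ :: "'a list \<Rightarrow> 'a mat" where
  "circ xs = (let n = length xs in mat n n (\<lambda>(j, k). xs ! ((n + k - j) mod n)))"

definition circulant_mat :: "'a mat \<Rightarrow> bool" where
  "circulant_mat M \<longleftrightarrow> (\<exists>xs. M = circ xs)"

definition symmetric_mat :: "'a mat \<Rightarrow> bool" where
  "symmetric_mat M \<longleftrightarrow> transpose_mat M = M"

definition Williamson_matrices ::
    "nat \<Rightarrow> int mat \<Rightarrow> int mat \<Rightarrow> int mat \<Rightarrow> int mat \<Rightarrow> bool" where
  "Williamson_matrices n A B C D \<longleftrightarrow>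
    (\<forall>M \<in> {A, B, C, D}. M \<in> carrier_mat n n \<and> elements_mat M \<subseteq> {1, -1} \<and>
       symmetric_mat M \<and> circulant_mat M) \<and>
    A ^\<^sub>m 2 + B ^\<^sub>m 2 + C ^\<^sub>m 2 + D ^\<^sub>m 2 = (4 * int n) \<cdot>\<^sub>m 1\<^sub>m n"

definition Williamson_sequence ::
    "nat \<Rightarrow> int list \<Rightarrow> int list \<Rightarrow> int list \<Rightarrow> int list \<Rightarrow> bool" where
  "Williamson_sequence n A B C D \<longleftrightarrow>
    (\<forall>X \<in> {A, B, C, D}. length X = n \<and> set X \<subseteq> {1, -1}) \<and>
    Williamson_matrices n (circ A) (circ B) (circ C) (circ D)"

end

theory Submission
  imports Defs "HOL-Number_Theory.Cong"
begin

text \<open>The entry of index k in the first row of a squared circulant matrix is the sum of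
  x i * x (k - i), the indices being taken modulo n. The reflection that sends i to k - i pairs
  its terms, and as (x i - 1) * (x (k - i) - 1) is divisible by 4, the sum is determined modulo 8
  by the total of the x i and by the fixed points of the reflection. For k = 1 there are no fixed
  points, since n is even; for k = 2 * j they are j and j + m. Comparing the two cases shows that
  the eight entries of index j and j + m sum to a multiple of 4, so an even number of them are -1.\<close>

text \<open>Off its fixed points, \<open>\<sigma>\<close> swaps the indices with i <
  \<open>\<sigma>\<close> i and those with \<open>\<sigma>\<close> i < i. Both halves have the same
  sum, a multiple of d, so together they vanish modulo 2 * d.\<close>

lemma sum_involution_cong:
  fixes g :: "nat \<Rightarrow> int"
  assumes "finite S"
    and maps: "\<And>i. i \<in> S \<Longrightarrow> \<sigma> i \<in> S"
    and invol: "\<And>i. i \<in> S \<Longrightarrow> \<sigma> (\<sigma> i) = i"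
    and inv: "\<And>i. i \<in> S \<Longrightarrow> g (\<sigma> i) = g i"
    and dvd: "\<And>i. i \<in> S \<Longrightarrow> d dvd g i"
  shows "[sum g S = sum g {i\<in>S. \<sigma> i = i}] (mod (2 * d))"
proof -
  let ?F = "{i\<in>S. \<sigma> i = i}" and ?L = "{i\<in>S. i < \<sigma> i}" and ?G = "{i\<in>S. \<sigma> i < i}"
  have "S = ?F \<union> (?L \<union> ?G)"
    by auto
  moreover have "sum g (?F \<union> (?L \<union> ?G)) = sum g ?F + (sum g ?L + sum g ?G)"
    using \<open>finite S\<close> by (subst sum.union_disjoint; (subst sum.union_disjoint)?; auto)
  moreover have "sum g ?L = sum g ?G"
    by (rule sum.reindex_bij_witness[of _ \<sigma> \<sigma>]) (auto simp: maps invol inv)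
  moreover have "d dvd sum g ?L"
    by (rule dvd_sum) (simp add: dvd)
  ultimately have "2 * d dvd sum g S - sum g ?F"
    by (simp add: mult_dvd_mono flip: mult_2)
  then show ?thesis
    by (simp add: cong_iff_dvd_diff)
qed

definition reflect :: "nat \<Rightarrow> nat \<Rightarrow> nat \<Rightarrow> nat" where
  "reflect n k i = (n + k - i) mod n"

lemma reflect_eq:
  assumes "k < n" "i < n"
  shows "reflect n k i = (if i \<le> k then k - i else n + k - i)"
proof (cases "i \<le> k")
  case True
  then have "n + k - i = (k - i) + n"
    by simp
  then show ?thesis
    using assms True unfolding reflect_def by (simp only: mod_add_self2) simp
qed (use assms in \<open>simp add: reflect_def\<close>)

lemma reflect_less: "k < n \<Longrightarrow> i < n \<Longrightarrow> reflect n k i < n"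
  by (auto simp: reflect_eq)

lemma reflect_reflect: "k < n \<Longrightarrow> i < n \<Longrightarrow> reflect n k (reflect n k i) = i"
  using reflect_less[of k n i] by (auto simp: reflect_eq)

text \<open>Parity: a fixed point would give 2 * i = 1 or 2 * i = 2 * m + 1.\<close>

lemma reflect_fixed_points_one:
  assumes "m \<ge> 1"
  shows "{i\<in>{..<2 * m}. reflect (2 * m) 1 i = i} = {}"
proof -
  have "reflect (2 * m) 1 i \<noteq> i" if "i < 2 * m" for i
  proof -
    have "1 - i \<noteq> i" if "i \<le> 1"
      using that by presburger
    moreover have "2 * m + 1 - i \<noteq> i"
      by presburger
    ultimately show ?thesis
      using reflect_eq[of 1 "2 * m" i] that assms by simp
  qed
  then show ?thesis
    by auto
qed

text \<open>Modulo 2 * m, 2 * i = 2 * j amounts to i = j modulo m, which leaves two indices below 2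
  * m.\<close>

lemma reflect_fixed_points_double:
  assumes "j < m"
  shows "{i\<in>{..<2 * m}. reflect (2 * m) (2 * j) i = i} = {j, j + m}"
proof -
  have "reflect (2 * m) (2 * j) i = i \<longleftrightarrow> i = j \<or> i = j + m" if "i < 2 * m" for i
    using that assms by (auto simp: reflect_eq)
  then show ?thesis
    using assms by auto
qed

definition circular_convolution :: "nat \<Rightarrow> (nat \<Rightarrow> int) \<Rightarrow> nat \<Rightarrow> int" where
  "circular_convolution n x k = (\<Sum>i<n. x i * x (reflect n k i))"

text \<open>With y = x (k - i), write x i * y = (x i - 1) * (y - 1) + x i + y - 1. The linear terms
  give twice the total, as the reflection permutes the indices. At a fixed point the product is (x i
  - 1)^2 = 2 - 2 * x i, because (x i)^2 = 1.\<close>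

lemma circular_convolution_cong:
  fixes x :: "nat \<Rightarrow> int"
  assumes "k < n" and pm: "\<And>i. i < n \<Longrightarrow> x i \<in> {1, -1}"
  shows "[circular_convolution n x k =
      2 * (\<Sum>i<n. x i) - int n + (\<Sum>i | i \<in> {..<n} \<and> reflect n k i = i. 2 - 2 * x i)] (mod 8)"
proof -
  let ?r = "reflect n k"
  let ?g = "\<lambda>i. (x i - 1) * (x (?r i) - 1)"
  let ?F = "{i\<in>{..<n}. ?r i = i}"
  have "(\<Sum>i<n. x (?r i)) = (\<Sum>i<n. x i)"
    by (rule sum.reindex_bij_witness[of _ ?r ?r])
      (auto simp: reflect_less reflect_reflect \<open>k < n\<close>)
  then have conv: "circular_convolution n x k = 2 * (\<Sum>i<n. x i) - int n + sum ?g {..<n}"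
    by (simp add: circular_convolution_def algebra_simps sum.distrib sum_subtractf)
  have four: "4 dvd ?g i" if "i < n" for i
    using pm[of i] pm[of "?r i"] that reflect_less[OF \<open>k < n\<close> that] by auto
  have "[sum ?g {..<n} = sum ?g ?F] (mod (2 * 4))"
    by (rule sum_involution_cong)
      (auto simp: reflect_less reflect_reflect \<open>k < n\<close> four mult.commute)
  moreover have "sum ?g ?F = (\<Sum>i\<in>?F. 2 - 2 * x i)"
    by (rule sum.cong) (use pm in force)+
  ultimately show ?thesis
    unfolding conv by (simp add: cong_add_lcancel)
qed

lemma circ_square_entry:
  fixes xs :: "int list"
  assumes "length xs = n" "k < n"
  shows "(circ xs ^\<^sub>m 2) $$ (0, k) = circular_convolution n ((!) xs) k"
proof -
  have "(circ xs ^\<^sub>m 2) $$ (0, k) = (\<Sum>i<n. xs ! ((n + i) mod n) * xs ! ((n + k - i) mod n))"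
    using assms by (simp add: circ_def Let_def numeral_2_eq_2 scalar_prod_def atLeast0LessThan)
  then show ?thesis
    by (simp add: circular_convolution_def reflect_def)
qed

lemma Williamson_convolution:
  assumes "Williamson_sequence n A B C D" "k < n"
  shows "(\<Sum>X\<leftarrow>[A, B, C, D]. circular_convolution n ((!) X) k) = (if k = 0 then 4 * int n else 0)"
proof -
  have len: "length A = n" "length B = n" "length C = n" "length D = n"
    and "circ A ^\<^sub>m 2 + circ B ^\<^sub>m 2 + circ C ^\<^sub>m 2 + circ D ^\<^sub>m 2 = (4 * int n) \<cdot>\<^sub>m 1\<^sub>m n"
    using assms by (auto simp: Williamson_sequence_def Williamson_matrices_def)
  then have "(circ A ^\<^sub>m 2 + circ B ^\<^sub>m 2 + circ C ^\<^sub>m 2 + circ D ^\<^sub>m 2) $$ (0, k)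
      = ((4 * int n) \<cdot>\<^sub>m 1\<^sub>m n) $$ (0, k)"
    by simp
  \<comment> \<open>Entrywise evaluation of a matrix sum has to know that the index lies within the
    dimensions of the powers.\<close>
  moreover have "dim_row (circ X ^\<^sub>m 2) = n" "dim_col (circ X ^\<^sub>m 2) = n"
    if "length X = n" for X :: "int list"
    using that pow_carrier_mat[of "circ X" n 2] by (auto simp: circ_def Let_def)
  ultimately show ?thesis
    using assms(2) len by (auto simp: circ_square_entry[OF _ assms(2)])
qed

text \<open>If r of the signs are -1, then the sum minus 3 is 1 - 2 * r, which modulo 4 is 1 for
  even r and -1 for odd r.\<close>

lemma sign_product_cong:
  fixes a b c d :: int
  assumes "a \<in> {1, -1}" "b \<in> {1, -1}" "c \<in> {1, -1}" "d \<in> {1, -1}"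
  shows "[a * b * c * d = a + b + c + d - 3] (mod 4)" "a * b * c * d \<in> {1, -1}"
  using assms by (auto simp: cong_def)

theorem theorem2:
  fixes m n :: nat and A B C D :: "int list"
  assumes "m \<ge> 1" and "n = 2 * m"
    and "Williamson_sequence n A B C D"
  shows "\<forall>i<m. A ! i * B ! i * C ! i * D ! i = A ! (i + m) * B ! (i + m) * C ! (i + m) * D ! (i + m)"
proof (intro allI impI)
  fix j assume "j < m"
  let ?conv = "\<lambda>k X. circular_convolution n ((!) X) k"
  let ?total = "\<lambda>X. \<Sum>i<n. X ! i"
  have pm: "X ! i \<in> {1, -1}" if "X \<in> {A, B, C, D}" "i < n" for X i
  proof -
    have "length X = n" "set X \<subseteq> {1, -1}"
      using assms(3) that(1) unfolding Williamson_sequence_def by blast+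
    then show ?thesis
      using nth_mem[of i X] that(2) by blast
  qed
  have one: "8 dvd ?conv 1 X - (2 * ?total X - int n)" if "X \<in> {A, B, C, D}" for X
    using circular_convolution_cong[of 1 n "(!) X"] pm[OF that] assms(1)
    unfolding assms(2) reflect_fixed_points_one[OF assms(1)] by (simp add: cong_iff_dvd_diff)
  have double: "8 dvd ?conv (2 * j) X
      - (2 * ?total X - int n + (4 - 2 * (X ! j + X ! (j + m))))" if "X \<in> {A, B, C, D}" for X
    using circular_convolution_cong[of "2 * j" n "(!) X"] pm[OF that] assms(1) \<open>j < m\<close>
    unfolding assms(2) reflect_fixed_points_double[OF \<open>j < m\<close>]
    by (simp add: cong_iff_dvd_diff algebra_simps)
  \<comment> \<open>Subtracting the two congruences cancels the unknown total and n.\<close>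
  let ?diff = "\<lambda>X. ?conv (2 * j) X - ?conv 1 X + 2 * (X ! j + X ! (j + m)) - 4"
  have diff: "8 dvd ?diff X" if "X \<in> {A, B, C, D}" for X
    using dvd_diff[OF double[OF that] one[OF that]] by (simp add: algebra_simps)
  \<comment> \<open>Index 1 is off the diagonal, as n is at least 2.\<close>
  have "?conv 1 A + ?conv 1 B + ?conv 1 C + ?conv 1 D = 0"
    using Williamson_convolution[OF assms(3), of 1] assms(1,2) by simp
  \<comment> \<open>The 16 collects the 4 subtracted in each of the four \<open>?diff\<close>
    terms.\<close>
  then have "2 * ((A ! j + B ! j + C ! j + D ! j)
        + (A ! (j + m) + B ! (j + m) + C ! (j + m) + D ! (j + m)))
      = ?diff A + ?diff B + ?diff C + ?diff D
        - (?conv (2 * j) A + ?conv (2 * j) B + ?conv (2 * j) C + ?conv (2 * j) D) + 16"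
    by (simp add: algebra_simps)
  \<comment> \<open>The sum is 0 unless j = 0, where it is the diagonal entry 4 * n = 8 * m.\<close>
  moreover have "8 dvd ?conv (2 * j) A + ?conv (2 * j) B + ?conv (2 * j) C + ?conv (2 * j) D"
    using Williamson_convolution[OF assms(3), of "2 * j"] \<open>j < m\<close> assms(2)
    by (simp add: add.assoc split: if_splits)
  moreover have "8 dvd ?diff A + ?diff B + ?diff C + ?diff D"
    by (intro dvd_add diff) simp_all
  moreover have sixteen: "(8::int) dvd 16"
    by simp
  ultimately have "8 dvd 2 * ((A ! j + B ! j + C ! j + D ! j)
      + (A ! (j + m) + B ! (j + m) + C ! (j + m) + D ! (j + m)))"
    by (metis dvd_add dvd_diff sixteen)
  then have "4 dvd (A ! j + B ! j + C ! j + D ! j)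
      + (A ! (j + m) + B ! (j + m) + C ! (j + m) + D ! (j + m))" (is "4 dvd ?s + ?t")
    by presburger
  moreover have "[A ! j * B ! j * C ! j * D ! j = ?s - 3] (mod 4)"
    "A ! j * B ! j * C ! j * D ! j \<in> {1, -1}"
    using \<open>j < m\<close> assms(2) by (intro sign_product_cong pm; simp)+
  moreover have "[A ! (j + m) * B ! (j + m) * C ! (j + m) * D ! (j + m) = ?t - 3] (mod 4)"
    "A ! (j + m) * B ! (j + m) * C ! (j + m) * D ! (j + m) \<in> {1, -1}"
    using \<open>j < m\<close> assms(2) by (intro sign_product_cong pm; simp)+
  \<comment> \<open>Here u + v is congruent to s + t - 6, hence to 2 modulo 4; opposite signs would
    give 0.\<close>
  moreover have "u = v"
    if "4 dvd s + t" "[u = s - 3] (mod 4)" "u \<in> {1, -1}" "[v = t - 3] (mod 4)" "v \<in> {1, -1}"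
    for s t u v :: int
    using that by (auto simp: cong_iff_dvd_diff) presburger+
  ultimately show "A ! j * B ! j * C ! j * D ! j
      = A ! (j + m) * B ! (j + m) * C ! (j + m) * D ! (j + m)"
    by blast
qed

end
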